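(* Let $\mathfrak{g}$ be the N=1 Heisenberg-Virasoro superalgebra, let $\lambda\in\mathbb{C}^*$, $\alpha=(\alpha_1,\alpha_2)\in\mathbb{C}\times\mathbb{C}$ and $\beta(H_0)\in\mathbb{C}[H_0]$. Then, as $\mathfrak{g}$-modules, $\mathcal{W}(\Omega'(\lambda,\beta))\cong A\big(\beta(-\alpha_2)-1,\,-\alpha_2,\,-\alpha_1\big)$.
   Context: All vector spaces are over $\mathbb{C}$; all modules over Lie superalgebras are $\mathbb{Z}_2$-graded. $\mathbb{C}^*$ is the set of nonzero complex numbers. The N=1 Heisenberg-Virasoro superalgebra $\mathfrak{g}$ is the Lie superalgebra with basis $L_m,H_m,C_1,C_2,C_3$ (even, $m\in\mathbb{Z}$) and $G_p,Q_p$ (odd, $p\in\mathbb{Z}+\frac12$), and brackets, for $m,n\in\mathbb{Z}$, $p,q\in\mathbb{Z}+\frac12$, $[L_m,L_n]=(m-n)L_{m+n}+\delta_{m+n,0}\frac{m^3-m}{12}C_1$, $[L_m,H_n]=-nH_{m+n}+\delta_{m+n,0}(m^2+m)C_2$, $[H_m,H_n]=m\delta_{m+n,0}C_3$, $[L_m,G_p]=(\frac m2-p)G_{m+p}$, $[L_m,Q_p]=-(\frac m2+p)Q_{m+p}$, $[H_m,G_p]=mQ_{m+p}$, $[G_p,G_q]=2L_{p+q}+\delta_{p+q,0}\frac{4p^2-1}{12}C_1$, $[G_p,Q_q]=H_{p+q}+(2p+1)\delta_{p+q,0}C_2$, $[Q_p,Q_q]=\delta_{p+q,0}C_3$, $[H_m,Q_p]=[\mathfrak{g},C_i]=0$.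 Put $\mathfrak{h}=\mathbb{C}L_0\oplus\mathbb{C}H_0$, so $U(\mathfrak{h})=\mathbb{C}[L_0,H_0]$. The module $\Omega'(\lambda,\beta)=\mathbb{C}[L_0,H_0]\mathbf{1}_{\bar0}\oplus\mathbb{C}[L_0,H_0]\mathbf{1}_{\bar1}$ (first summand even, second odd) has the following nontrivial actions, for $f=f(L_0,H_0)\in\mathbb{C}[L_0,H_0]$, $m\in\mathbb{Z}$, $p\in\mathbb{Z}+\frac12$: $L_mf\mathbf{1}_{\bar0}=\lambda^m(L_0+m\beta(H_0))f(L_0+m,H_0)\mathbf{1}_{\bar0}$, $L_mf\mathbf{1}_{\bar1}=\lambda^m(L_0+m(\beta(H_0)+\frac12))f(L_0+m,H_0)\mathbf{1}_{\bar1}$, $H_mf\mathbf{1}_{\bar i}=\lambda^mH_0f(L_0+m,H_0)\mathbf{1}_{\bar i}$ ($i=0,1$), $G_pf\mathbf{1}_{\bar0}=\lambda^{p-\frac12}f(L_0+p,H_0)\mathbf{1}_{\bar1}$, $G_pf\mathbf{1}_{\bar1}=\lambda^{p+\frac12}(L_0+2p\beta(H_0))f(L_0+p,H_0)\mathbf{1}_{\bar0}$, $Q_pf\mathbf{1}_{\bar1}=\lambda^{p+\frac12}H_0f(L_0+p,H_0)\mathbf{1}_{\bar0}$; the actions of $Q_p$ on $\mathbb{C}[L_0,H_0]\mathbf{1}_{\bar0}$ and of $C_1,C_2,C_3$ are zero. Weighting functor (relative to $\alpha$): for $n\in\mathbb{Z}$ and $\epsilon\in\{0,\frac12\}$ let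 $\mathcal{I}_{n+\epsilon+\alpha}$ be the maximal ideal of $U(\mathfrak{h})=\mathbb{C}[L_0,H_0]$ generated by $L_0+n+\epsilon+\alpha_1$ and $H_0+\alpha_2$. For a $\mathfrak{g}$-module $M$ set $M_{n+\epsilon+\alpha}=M/\mathcal{I}_{n+\epsilon+\alpha}M$ and $\mathcal{W}(M)=\bigoplus_{r\in\mathbb{Z}+\epsilon}M_{r+\alpha}$, where $\epsilon=\{0,\frac12\}$ (that is, $r$ runs over $\mathbb{Z}+\{0,\frac12\}$), with the nontrivial $\mathfrak{g}$-actions $X_k\cdot(v+\mathcal{I}_{n+\epsilon+\alpha}M)=X_kv+\mathcal{I}_{k+n+\epsilon+\alpha}M$ for $X_k=L_k,H_k$ ($k\in\mathbb{Z}$) and $X_k=G_k,Q_k$ ($k\in\mathbb{Z}+\frac12$). For $a,b,c\in\mathbb{C}$, the intermediate series module $A(a,b,c)$ over $\mathfrak{g}$ has basis $\{v_n^+,v_q^-\mid n\in\mathbb{Z},q\in\mathbb{Z}+\frac12\}$ and nontrivial actions, for $m\in\mathbb{Z}$, $p\in\mathbb{Z}+\frac12$, $L_mv_n^+=(c-n+ma)v_{n+m}^+$, $L_mv_q^-=(c-q+m(a+\frac12))v_{q+m}^-$, $H_mv_n^+=bv_{n+m}^+$, $H_mv_q^-=bv_{q+m}^-$, $G_pv_n^+=v_{p+n}^-$, $G_pv_q^-=(c-q+2p(a+\frac12))v_{p+q}^+$, $Q_pv_q^-=bv_{p+q}^+$.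
   Formalization: W(M) is taken as the sum of the even part of M/I_{r+α}M for r in Z and the odd part for r in Z+1/2; with the full quotients the claim fails, since each quotient of Ω' is 2-dimensional while the L_0-weight spaces of A are 1-dimensional. *)

theory Defs
  imports
    Complex_Main
    "HOL-Library.Poly_Mapping"
    "HOL-Library.Product_Plus"
    "HOL-Library.Z2"
    "HOL-Library.FuncSet"
    "HOL-Computational_Algebra.Polynomial"
    "HOL-Algebra.Module"
    "HOL-Algebra.AbelCoset"
    "HOL-Algebra.Generated_Groups"
begin

section \<open>The N=1 Heisenberg-Virasoro superalgebra\<close>

text \<open>The constructors \<open>G\<close> and \<open>Q\<close> are indexed by \<^typ>\<open>int\<close> instead of by half-odd-integers:
  \<open>G i\<close> and \<open>Q i\<close> stand for the elements usually written with index \<open>p = i + 1/2\<close>.\<close>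

datatype hv_basis = L int | H int | G int | Q int | C1 | C2 | C3

definition hf :: "int \<Rightarrow> complex" where
  "hf i = of_int i + 1/2"

type_synonym hv = "hv_basis \<Rightarrow>\<^sub>0 complex"

definition pm_scale :: "complex \<Rightarrow> ('k \<Rightarrow>\<^sub>0 complex) \<Rightarrow> ('k \<Rightarrow>\<^sub>0 complex)" where
  "pm_scale c x = Poly_Mapping.map ((*) c) x"

primrec hv_parity :: "hv_basis \<Rightarrow> bit" where
  "hv_parity (L m) = 0"
| "hv_parity (H m) = 0"
| "hv_parity (G i) = 1"
| "hv_parity (Q i) = 1"
| "hv_parity C1 = 0"
| "hv_parity C2 = 0"
| "hv_parity C3 = 0"

definition hv_part :: "bit \<Rightarrow> hv set" where
  "hv_part s = {x. \<forall>a \<in> Poly_Mapping.keys x. hv_parity a = s}"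

text \<open>For \<open>p = i + 1/2\<close> and \<open>q = j + 1/2\<close> one has \<open>p + q = i + j + 1\<close>.  The values that are not
  given in the usual presentation follow from super skew-symmetry.\<close>

fun hv_brk :: "hv_basis \<Rightarrow> hv_basis \<Rightarrow> hv" where
  "hv_brk (L m) (L n) = Poly_Mapping.single (L (m + n)) (of_int (m - n))
     + Poly_Mapping.single C1 (if m + n = 0 then of_int (m ^ 3 - m) / 12 else 0)"
| "hv_brk (L m) (H n) = Poly_Mapping.single (H (m + n)) (- of_int n)
     + Poly_Mapping.single C2 (if m + n = 0 then of_int (m ^ 2 + m) else 0)"
| "hv_brk (H n) (L m) = Poly_Mapping.single (H (m + n)) (of_int n)
     - Poly_Mapping.single C2 (if m + n = 0 then of_int (m ^ 2 + m) else 0)"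
| "hv_brk (H m) (H n) = Poly_Mapping.single C3 (if m + n = 0 then of_int m else 0)"
| "hv_brk (L m) (G i) = Poly_Mapping.single (G (m + i)) (of_int m / 2 - hf i)"
| "hv_brk (G i) (L m) = Poly_Mapping.single (G (m + i)) (- (of_int m / 2 - hf i))"
| "hv_brk (L m) (Q i) = Poly_Mapping.single (Q (m + i)) (- (of_int m / 2 + hf i))"
| "hv_brk (Q i) (L m) = Poly_Mapping.single (Q (m + i)) (of_int m / 2 + hf i)"
| "hv_brk (H m) (G i) = Poly_Mapping.single (Q (m + i)) (of_int m)"
| "hv_brk (G i) (H m) = Poly_Mapping.single (Q (m + i)) (- of_int m)"
| "hv_brk (G i) (G j) = Poly_Mapping.single (L (i + j + 1)) 2
     + Poly_Mapping.single C1 (if i + j + 1 = 0 then (4 * hf i ^ 2 - 1) / 12 else 0)"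
| "hv_brk (G i) (Q j) = Poly_Mapping.single (H (i + j + 1)) 1
     + Poly_Mapping.single C2 (if i + j + 1 = 0 then 2 * hf i + 1 else 0)"
| "hv_brk (Q j) (G i) = Poly_Mapping.single (H (i + j + 1)) 1
     + Poly_Mapping.single C2 (if i + j + 1 = 0 then 2 * hf i + 1 else 0)"
| "hv_brk (Q i) (Q j) = Poly_Mapping.single C3 (if i + j + 1 = 0 then 1 else 0)"
| "hv_brk _ _ = 0"

definition hv_bracket :: "hv \<Rightarrow> hv \<Rightarrow> hv" where
  "hv_bracket x y = (\<Sum>a \<in> Poly_Mapping.keys x. \<Sum>b \<in> Poly_Mapping.keys y.
     pm_scale (Poly_Mapping.lookup x a * Poly_Mapping.lookup y b) (hv_brk a b))"


section \<open>Graded modules over the superalgebra\<close>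

definition complex_ring :: "complex ring" where
  "complex_ring = \<lparr>carrier = UNIV, mult = (*), one = 1, zero = 0, add = (+)\<rparr>"

record 'v hv_mod = "(complex, 'v) module" +
  part :: "bit \<Rightarrow> 'v set"
  act :: "hv \<Rightarrow> 'v \<Rightarrow> 'v"

locale hv_module = module complex_ring M for M :: "'v hv_mod" (structure) +
  assumes part_submodule: "submodule (part M s) complex_ring M"
    and part_sum: "carrier M = part M 0 <+>\<^bsub>M\<^esub> part M 1"
    and part_disjoint: "part M 0 \<inter> part M 1 = {\<zero>}"
    and act_part: "\<lbrakk>x \<in> hv_part s; v \<in> part M t\<rbrakk> \<Longrightarrow> act M x v \<in> part M (s + t)"
    and act_closed: "v \<in> carrier M \<Longrightarrow> act M x v \<in> carrier M"
    and act_add_left: "v \<in> carrier M \<Longrightarrow> act M (x + y) v = act M x v \<oplus> act M y v"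
    and act_scale_left: "v \<in> carrier M \<Longrightarrow> act M (pm_scale c x) v = c \<odot>\<^bsub>M\<^esub> act M x v"
    and act_add_right:
      "\<lbrakk>v \<in> carrier M; w \<in> carrier M\<rbrakk> \<Longrightarrow> act M x (v \<oplus> w) = act M x v \<oplus> act M x w"
    and act_scale_right: "v \<in> carrier M \<Longrightarrow> act M x (c \<odot>\<^bsub>M\<^esub> v) = c \<odot>\<^bsub>M\<^esub> act M x v"
    and act_bracket:
      "\<lbrakk>x \<in> hv_part s; y \<in> hv_part t; v \<in> carrier M\<rbrakk> \<Longrightarrow>
        act M (hv_bracket x y) v =
          act M x (act M y v) \<ominus> (if s = 1 \<and> t = 1 then -1 else 1) \<odot>\<^bsub>M\<^esub> act M y (act M x v)"

definition hv_iso :: "'v hv_mod \<Rightarrow> 'w hv_mod \<Rightarrow> bool" (infix \<open>\<cong>\<^sub>\<gg>\<close> 50) where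
  "M \<cong>\<^sub>\<gg> N \<longleftrightarrow> hv_module M \<and> hv_module N \<and>
     (\<exists>\<phi> \<in> iso (add_monoid M) (add_monoid N).
        (\<forall>c. \<forall>v \<in> carrier M. \<phi> (c \<odot>\<^bsub>M\<^esub> v) = c \<odot>\<^bsub>N\<^esub> \<phi> v) \<and>
        (\<forall>s. \<phi> ` part M s = part N s) \<and>
        (\<forall>x. \<forall>v \<in> carrier M. \<phi> (act M x v) = act N x (\<phi> v)))"

definition make_hv_mod ::
  "(complex, 'v) module \<Rightarrow> (bit \<Rightarrow> 'v set) \<Rightarrow> (hv_basis \<Rightarrow> 'v \<Rightarrow> 'v) \<Rightarrow> 'v hv_mod" where
  "make_hv_mod V P f = module.extend V (hv_mod.fields P
     (\<lambda>x v. \<Oplus>\<^bsub>V\<^esub>a \<in> Poly_Mapping.keys x. Poly_Mapping.lookup x a \<odot>\<^bsub>V\<^esub> f a v))"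


section \<open>The modules \<open>\<Omega>'(\<lambda>,\<beta>)\<close>\<close>

text \<open>\<open>\<complex>[L\<^sub>0,H\<^sub>0]\<close> is \<^typ>\<open>complex poly poly\<close>: the outer variable is \<open>L\<^sub>0\<close>, the inner one is \<open>H\<^sub>0\<close>.\<close>

definition L0 :: "complex poly poly" where "L0 = [:0, 1:]"
definition H0 :: "complex poly poly" where "H0 = [:[:0, 1:]:]"
definition cst :: "complex \<Rightarrow> complex poly poly" where "cst c = [:[:c:]:]"

text \<open>\<open>f(L\<^sub>0,H\<^sub>0)\<close> becomes \<open>f(L\<^sub>0 + r,H\<^sub>0)\<close>.\<close>

definition shift :: "complex \<Rightarrow> complex poly poly \<Rightarrow> complex poly poly" where
  "shift r f = f \<circ>\<^sub>p (L0 + cst r)"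

text \<open>A pair \<open>(f, g)\<close> is the vector with even component \<open>f\<close> and odd component \<open>g\<close>; for
  \<open>p = i + 1/2\<close> the exponents \<open>p - 1/2\<close> and \<open>p + 1/2\<close> of \<open>\<lambda>\<close> are \<open>i\<close> and \<open>i + 1\<close>.\<close>

primrec Omega_gen :: "complex \<Rightarrow> complex poly \<Rightarrow> hv_basis \<Rightarrow>
    complex poly poly \<times> complex poly poly \<Rightarrow> complex poly poly \<times> complex poly poly" where
  "Omega_gen l b (L m) = (\<lambda>(f, g).
     (cst (l powi m) * (L0 + cst (of_int m) * [:b:]) * shift (of_int m) f,
      cst (l powi m) * (L0 + cst (of_int m) * ([:b:] + cst (1/2))) * shift (of_int m) g))"
| "Omega_gen l b (H m) = (\<lambda>(f, g).
     (cst (l powi m) * H0 * shift (of_int m) f, cst (l powi m) * H0 * shift (of_int m) g))"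
| "Omega_gen l b (G i) = (\<lambda>(f, g).
     (cst (l powi (i + 1)) * (L0 + cst (2 * hf i) * [:b:]) * shift (hf i) g,
      cst (l powi i) * shift (hf i) f))"
| "Omega_gen l b (Q i) = (\<lambda>(f, g). (cst (l powi (i + 1)) * H0 * shift (hf i) g, 0))"
| "Omega_gen l b C1 = (\<lambda>_. 0)"
| "Omega_gen l b C2 = (\<lambda>_. 0)"
| "Omega_gen l b C3 = (\<lambda>_. 0)"

definition Omega ::
  "complex \<Rightarrow> complex poly \<Rightarrow> (complex poly poly \<times> complex poly poly) hv_mod" where
  "Omega l b = make_hv_mod
     \<lparr>carrier = UNIV, mult = undefined, one = undefined, zero = 0, add = (+),
      smult = (\<lambda>c (f, g). (cst c * f, cst c * g))\<rparr>
     (\<lambda>s. if s = 0 then UNIV \<times> {0} else {0} \<times> UNIV)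
     (Omega_gen l b)"


section \<open>The intermediate series modules\<close>

text \<open>\<open>Vplus n\<close> is \<open>v\<^sup>+\<close> with index \<open>n\<close> and \<open>Vminus j\<close> is \<open>v\<^sup>-\<close> with index \<open>q = j + 1/2\<close>.\<close>

datatype series_basis = Vplus int | Vminus int

fun series_gen :: "complex \<Rightarrow> complex \<Rightarrow> complex \<Rightarrow> hv_basis \<Rightarrow> series_basis \<Rightarrow>
    (series_basis \<Rightarrow>\<^sub>0 complex)" where
  "series_gen a b c (L m) (Vplus n) =
     Poly_Mapping.single (Vplus (n + m)) (c - of_int n + of_int m * a)"
| "series_gen a b c (L m) (Vminus j) =
     Poly_Mapping.single (Vminus (j + m)) (c - hf j + of_int m * (a + 1/2))"
| "series_gen a b c (H m) (Vplus n) = Poly_Mapping.single (Vplus (n + m)) b"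
| "series_gen a b c (H m) (Vminus j) = Poly_Mapping.single (Vminus (j + m)) b"
| "series_gen a b c (G i) (Vplus n) = Poly_Mapping.single (Vminus (i + n)) 1"
| "series_gen a b c (G i) (Vminus j) =
     Poly_Mapping.single (Vplus (i + j + 1)) (c - hf j + 2 * hf i * (a + 1/2))"
| "series_gen a b c (Q i) (Vminus j) = Poly_Mapping.single (Vplus (i + j + 1)) b"
| "series_gen a b c _ _ = 0"

definition series :: "complex \<Rightarrow> complex \<Rightarrow> complex \<Rightarrow> (series_basis \<Rightarrow>\<^sub>0 complex) hv_mod" where
  "series a b c = make_hv_mod
     \<lparr>carrier = UNIV, mult = undefined, one = undefined, zero = 0, add = (+), smult = pm_scale\<rparr>
     (\<lambda>s. {v. Poly_Mapping.keys v \<subseteq> (if s = 0 then range Vplus else range Vminus)})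
     (\<lambda>x v. \<Sum>k \<in> Poly_Mapping.keys v.
        pm_scale (Poly_Mapping.lookup v k) (series_gen a b c x k))"


section \<open>The weighting functor\<close>

text \<open>Action of \<open>U(\<hh>) = \<complex>[L\<^sub>0,H\<^sub>0]\<close> obtained by restricting a module to \<open>\<hh> = \<complex>L\<^sub>0 \<oplus> \<complex>H\<^sub>0\<close>.\<close>

definition Uh_act :: "'v hv_mod \<Rightarrow> complex poly poly \<Rightarrow> 'v \<Rightarrow> 'v" where
  "Uh_act M u v = (\<Oplus>\<^bsub>M\<^esub>i \<in> {..degree u}. \<Oplus>\<^bsub>M\<^esub>j \<in> {..degree (coeff u i)}.
     coeff (coeff u i) j \<odot>\<^bsub>M\<^esub>
       ((act M (Poly_Mapping.single (L 0) 1) ^^ i) ((act M (Poly_Mapping.single (H 0) 1) ^^ j) v)))"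

definition wt_ideal :: "complex \<times> complex \<Rightarrow> complex \<Rightarrow> complex poly poly set" where
  "wt_ideal \<alpha> r = {u * (L0 + cst (r + fst \<alpha>)) + w * (H0 + cst (snd \<alpha>)) | u w. True}"

definition wt_sub :: "complex \<times> complex \<Rightarrow> 'v hv_mod \<Rightarrow> complex \<Rightarrow> 'v set" where
  "wt_sub \<alpha> M r =
     generate (add_monoid M) {Uh_act M u v | u v. u \<in> wt_ideal \<alpha> r \<and> v \<in> carrier M}"

text \<open>The index set \<open>\<int> \<union> (\<int> + 1/2)\<close> of the direct sum.\<close>

definition half_ints :: "complex set" where
  "half_ints = {r. 2 * r \<in> \<int>}"

text \<open>The direct sum over all \<open>r \<in> half_ints\<close> of the full quotients \<open>M / I M\<close>; an element is the
  family of its components, which are cosets.  Sums with \<open>wt_sub \<alpha> M r\<close> turn the image of a coset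
  under a map preserving the submodules in question into a coset again.\<close>

definition full_weighting_space ::
  "complex \<times> complex \<Rightarrow> 'v hv_mod \<Rightarrow> (complex, complex \<Rightarrow> 'v set) module" where
  "full_weighting_space \<alpha> M =
     \<lparr>carrier = {w \<in> \<Pi>\<^sub>E r \<in> half_ints. a_rcosets\<^bsub>M\<^esub> (wt_sub \<alpha> M r).
                 finite {r \<in> half_ints. w r \<noteq> wt_sub \<alpha> M r}},
      mult = undefined, one = undefined,
      zero = (\<lambda>r \<in> half_ints. wt_sub \<alpha> M r),
      add = (\<lambda>w w'. \<lambda>r \<in> half_ints. w r <+>\<^bsub>M\<^esub> w' r),
      smult = (\<lambda>c w. \<lambda>r \<in> half_ints. wt_sub \<alpha> M r <+>\<^bsub>M\<^esub> ((\<lambda>v. c \<odot>\<^bsub>M\<^esub> v) ` w r))\<rparr>"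

primrec hv_deg :: "hv_basis \<Rightarrow> complex" where
  "hv_deg (L m) = of_int m"
| "hv_deg (H m) = of_int m"
| "hv_deg (G i) = hf i"
| "hv_deg (Q i) = hf i"
| "hv_deg C1 = 0"
| "hv_deg C2 = 0"
| "hv_deg C3 = 0"

text \<open>\<open>X\<^sub>k\<close> sends the component with index \<open>r - k\<close> to the one with index \<open>r\<close>; the central
  elements act as zero.\<close>

definition weighting_gen ::
  "complex \<times> complex \<Rightarrow> 'v hv_mod \<Rightarrow> hv_basis \<Rightarrow> (complex \<Rightarrow> 'v set) \<Rightarrow> (complex \<Rightarrow> 'v set)" where
  "weighting_gen \<alpha> M a w = (\<lambda>r \<in> half_ints.
     if a \<in> {C1, C2, C3} then wt_sub \<alpha> M r
     else wt_sub \<alpha> M r <+>\<^bsub>M\<^esub> (act M (Poly_Mapping.single a 1) ` w (r - hv_deg a)))"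

definition full_weighting ::
  "complex \<times> complex \<Rightarrow> 'v hv_mod \<Rightarrow> (complex \<Rightarrow> 'v set) hv_mod" where
  "full_weighting \<alpha> M = make_hv_mod (full_weighting_space \<alpha> M)
     (\<lambda>s. {w \<in> carrier (full_weighting_space \<alpha> M).
            \<forall>r \<in> half_ints. \<exists>v \<in> part M s. w r = wt_sub \<alpha> M r +>\<^bsub>M\<^esub> v})
     (weighting_gen \<alpha> M)"

text \<open>The weighting functor of graded modules: the parity of a component is tied to its index, so
  that the components with index in \<open>\<int>\<close> are the even parts and those with index in \<open>\<int> + 1/2\<close>
  are the odd parts of the quotients \<open>M / I M\<close>.  As \<open>L\<^sub>k, H\<^sub>k\<close> (even) have \<open>k \<in> \<int>\<close> and
  \<open>G\<^sub>k, Q\<^sub>k\<close> (odd) have \<open>k \<in> \<int> + 1/2\<close>, this is a graded submodule of \<open>full_weighting \<alpha> M\<close>.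
  The latter is twice as large: for \<open>M = Omega l b\<close> it is the direct sum of two intermediate
  series modules, one for each way of tying parity to the index.\<close>

definition index_parity :: "complex \<Rightarrow> bit" where
  "index_parity r = (if r \<in> \<int> then 0 else 1)"

definition weighting ::
  "complex \<times> complex \<Rightarrow> 'v hv_mod \<Rightarrow> (complex \<Rightarrow> 'v set) hv_mod" where
  "weighting \<alpha> M =
     (let W = full_weighting \<alpha> M;
          K = {w \<in> carrier W. \<forall>r \<in> half_ints.
                 \<exists>v \<in> part M (index_parity r). w r = wt_sub \<alpha> M r +>\<^bsub>M\<^esub> v}
      in W\<lparr>carrier := K, part := (\<lambda>s. part W s \<inter> K)\<rparr>)"

end

theory Submission
  imports Defs
begin

text \<open>
  The quotient of \<open>\<complex>[L\<^sub>0,H\<^sub>0]\<close> by the maximal ideal of index \<open>r\<close> is \<open>\<complex>\<close>, via evaluation at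
  \<open>L\<^sub>0 = -(r + \<alpha>\<^sub>1)\<close>, \<open>H\<^sub>0 = -\<alpha>\<^sub>2\<close> (\<open>wt_ideal_eq\<close>).  Since \<open>L\<^sub>0\<close> and \<open>H\<^sub>0\<close> act on \<open>\<Omega>'\<close> by multiplication,
  the quotient of \<open>\<Omega>'\<close> of index \<open>r\<close> is \<open>\<complex> \<times> \<complex>\<close>, an even and an odd line (\<open>wt_sub_Omega\<close>).  The
  weighting module keeps the line whose parity fits the index, so it has one basis vector for each
  integer and one for each element of \<open>\<int> + 1/2\<close>, like the intermediate series.

  An element of degree \<open>k\<close> acts on \<open>\<Omega>'\<close> by the shift \<open>f(L\<^sub>0 + k, H\<^sub>0)\<close> followed by multiplication with a
  polynomial and a power of \<open>\<lambda>\<close>.  The shift matches the evaluation points of the indices \<open>r - k\<close> and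
  \<open>r\<close>, and the value of the polynomial at the target point is the structure constant of
  \<open>A(\<beta>(-\<alpha>\<^sub>2) - 1, -\<alpha>\<^sub>2, -\<alpha>\<^sub>1)\<close> (\<open>Omega_gen_level\<close>).  The powers of \<open>\<lambda>\<close> form a coboundary and disappear
  after rescaling the basis vectors with index \<open>n\<close> or \<open>n + 1/2\<close> by \<open>\<lambda>\<^bsup>n\<^esup>\<close>.

  The isomorphism \<open>coset_family\<close> is constructed from the intermediate series to the weighting module.
  That the intermediate series satisfies the module laws is a computation with structure constants
  (\<open>hv_module_series\<close>); the weighting module inherits them along the bijection
  (\<open>hv_iso_transport\<close>).
\<close>

section \<open>Complex vector spaces as records\<close>

lemma cring_complex_ring: "cring complex_ring"
proof (rule cringI)
  show "abelian_group complex_ring"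
  proof (rule abelian_groupI)
    fix x assume "x \<in> carrier complex_ring"
    show "\<exists>y\<in>carrier complex_ring. y \<oplus>\<^bsub>complex_ring\<^esub> x = \<zero>\<^bsub>complex_ring\<^esub>"
      by (rule bexI[of _ "- x"]) (auto simp: complex_ring_def)
  qed (auto simp: complex_ring_def)
  show "comm_monoid complex_ring"
    by (rule comm_monoidI) (auto simp: complex_ring_def)
qed (auto simp: complex_ring_def algebra_simps)

lemma abelian_group_UNIV:
  fixes V :: "('v::ab_group_add, 'm) ring_scheme"
  assumes "carrier V = UNIV" "add V = (+)" "zero V = 0"
  shows "abelian_group V"
proof (rule abelian_groupI)
  fix x assume "x \<in> carrier V"
  show "\<exists>y\<in>carrier V. y \<oplus>\<^bsub>V\<^esub> x = \<zero>\<^bsub>V\<^esub>"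
    by (rule bexI[of _ "- x"]) (auto simp: assms)
qed (auto simp: assms algebra_simps)

lemma finsum_UNIV:
  fixes V :: "('v::ab_group_add, 'm) ring_scheme"
  assumes "carrier V = UNIV" "add V = (+)" "zero V = 0"
  shows "finsum V f A = sum f A"
proof -
  interpret abelian_group V by (rule abelian_group_UNIV[OF assms])
  show ?thesis
    by (induction A rule: infinite_finite_induct)
      (auto simp: assms finsum_infinite finsum_insert)
qed

lemma a_inv_UNIV:
  fixes V :: "('v::ab_group_add, 'm) ring_scheme"
  assumes "carrier V = UNIV" "add V = (+)" "zero V = 0"
  shows "\<ominus>\<^bsub>V\<^esub> v = - v"
proof -
  interpret abelian_group V by (rule abelian_group_UNIV[OF assms])
  show ?thesis by (rule minus_equality) (auto simp: assms)
qed

section \<open>Transport of the module structure\<close>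

text \<open>All module axioms are equations and inclusions between elements of the carrier, so they hold
  in \<open>M\<close> as soon as they hold in \<open>N\<close> and \<open>\<psi>\<close> is a bijection compatible with every operation.  In
  this way a module law that is awkward to verify on a quotient is verified on a space with a basis.
  The isomorphism itself is the inverse of \<open>\<psi>\<close>.\<close>

lemma hv_iso_transport:
  fixes M :: "'v hv_mod" and N :: "'w hv_mod"
  assumes N: "hv_module N"
    and bij: "bij_betw \<psi> (carrier N) (carrier M)"
    and zero: "\<psi> \<zero>\<^bsub>N\<^esub> = \<zero>\<^bsub>M\<^esub>"
    and add: "\<And>v w. \<lbrakk>v \<in> carrier N; w \<in> carrier N\<rbrakk> \<Longrightarrow> \<psi> (v \<oplus>\<^bsub>N\<^esub> w) = \<psi> v \<oplus>\<^bsub>M\<^esub> \<psi> w"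
    and smult: "\<And>c v. v \<in> carrier N \<Longrightarrow> \<psi> (c \<odot>\<^bsub>N\<^esub> v) = c \<odot>\<^bsub>M\<^esub> \<psi> v"
    and part: "\<And>s. \<psi> ` part N s = part M s"
    and act: "\<And>x v. v \<in> carrier N \<Longrightarrow> \<psi> (act N x v) = act M x (\<psi> v)"
  shows "M \<cong>\<^sub>\<gg> N"
proof -
  interpret N: hv_module N by (rule N)
  have C: "x \<in> carrier complex_ring" for x
    by (simp add: complex_ring_def)
  have pre: "\<exists>v \<in> carrier N. w = \<psi> v" if "w \<in> carrier M" for w
    using that bij by (auto simp: bij_betw_def)
  have im: "\<psi> v \<in> carrier M" if "v \<in> carrier N" for v
    using that bij by (auto simp: bij_betw_def)
  have inj: "v = w" if "\<psi> v = \<psi> w" "v \<in> carrier N" "w \<in> carrier N" for v w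
    using that bij by (auto simp: bij_betw_def inj_on_def)
  have pN: "part N s \<subseteq> carrier N" for s
    using N.submoduleE(1)[OF N.part_submodule] .
  interpret M: abelian_group M
  proof (rule abelian_groupI)
    fix x assume "x \<in> carrier M"
    then obtain v where v: "v \<in> carrier N" "x = \<psi> v" using pre by blast
    show "\<exists>y\<in>carrier M. y \<oplus>\<^bsub>M\<^esub> x = \<zero>\<^bsub>M\<^esub>"
      by (rule bexI[of _ "\<psi> (\<ominus>\<^bsub>N\<^esub> v)"])
        (simp_all add: v im add[symmetric] zero[symmetric] N.M.l_neg)
  qed (auto dest!: pre simp: add[symmetric] zero[symmetric] im N.M.add.m_ac)
  have neg: "\<ominus>\<^bsub>M\<^esub> \<psi> v = \<psi> (\<ominus>\<^bsub>N\<^esub> v)" if "v \<in> carrier N" for v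
    using that by (intro M.minus_equality) (simp_all add: im add[symmetric] zero[symmetric] N.M.l_neg)
  interpret M: module complex_ring M
    using M.abelian_group_axioms
    by (intro moduleI cring_complex_ring)
      (auto dest!: pre simp: C add[symmetric] smult[symmetric] im N.smult_l_distr
        N.smult_r_distr N.smult_assoc1)
  have "hv_module M"
  proof (intro hv_module.intro hv_module_axioms.intro)
    show "module complex_ring M" by (rule M.module_axioms)
    show "submodule (part M s) complex_ring M" for s
    proof (rule M.submoduleI)
      show "part M s \<subseteq> carrier M" using pN im by (auto simp: part[symmetric])
      show "\<zero>\<^bsub>M\<^esub> \<in> part M s"
        using subgroup.one_closed[OF submodule.axioms(1)[OF N.part_submodule[of s]]]
        by (auto simp: part[symmetric] zero[symmetric])
      show "\<ominus>\<^bsub>M\<^esub> a \<in> part M s" if "a \<in> part M s" for a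
        using that pN N.submoduleE(3)[OF N.part_submodule[of s]]
        by (fastforce simp: part[symmetric] neg)
      show "a \<oplus>\<^bsub>M\<^esub> b \<in> part M s" if "a \<in> part M s" "b \<in> part M s" for a b
        using that pN[of s] N.submoduleE(5)[OF N.part_submodule[of s]]
        by (auto simp: part[symmetric] add[symmetric] subset_iff)
      show "a \<odot>\<^bsub>M\<^esub> x \<in> part M s" if "x \<in> part M s" for a x
        using that pN[of s] N.submoduleE(4)[OF N.part_submodule[of s] C]
        by (auto simp: part[symmetric] smult[symmetric] subset_iff)
    qed
    have "carrier M = \<psi> ` (part N 0 <+>\<^bsub>N\<^esub> part N 1)"
      using bij by (simp add: N.part_sum[symmetric] bij_betw_def)
    also have "\<dots> = part M 0 <+>\<^bsub>M\<^esub> part M 1"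
      using pN by (force simp: set_add_def' part[symmetric] add[symmetric] subset_iff image_UN)
    finally show "carrier M = part M 0 <+>\<^bsub>M\<^esub> part M 1" .
    have "part M 0 \<inter> part M 1 = \<psi> ` (part N 0 \<inter> part N 1)"
      using pN by (auto simp: part[symmetric] subset_iff dest!: inj)
    then show "part M 0 \<inter> part M 1 = {\<zero>\<^bsub>M\<^esub>}"
      by (simp add: N.part_disjoint zero)
    show "act M x v \<in> part M (s + t)" if "x \<in> hv_part s" "v \<in> part M t" for x s v t
    proof -
      from that(2) obtain u where u: "u \<in> part N t" "v = \<psi> u"
        by (auto simp: part[symmetric])
      moreover have "u \<in> carrier N" using u(1) pN by blast
      ultimately show ?thesis
        unfolding part[symmetric] using N.act_part[OF that(1) u(1)]
        by (simp add: act[symmetric] del: add_bit_eq_xor)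
    qed
    show "act M (hv_bracket x y) v =
          act M x (act M y v) \<ominus>\<^bsub>M\<^esub> (if s = 1 \<and> t = 1 then -1 else 1) \<odot>\<^bsub>M\<^esub> act M y (act M x v)"
      if "x \<in> hv_part s" "y \<in> hv_part t" "v \<in> carrier M" for x s y t v
    proof -
      from pre[OF that(3)] obtain u where u: "u \<in> carrier N" "v = \<psi> u" by blast
      show ?thesis
        unfolding u(2) a_minus_def
        by (simp only: act[symmetric] u N.act_closed smult[symmetric] N.smult_closed C neg
            add[symmetric] N.M.a_inv_closed N.act_bracket[OF that(1,2) u(1)] a_minus_def)
    qed
  qed (auto dest!: pre simp: act[symmetric] add[symmetric] smult[symmetric] im N.act_closed
      N.act_add_left N.act_scale_left N.act_add_right N.act_scale_right C)
  moreover have "inv_into (carrier N) \<psi> \<in> iso (add_monoid M) (add_monoid N)"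
    using bij_betw_inv_into[OF bij] 
    by (auto simp: iso_def hom_def dest!: pre)
      (auto simp: add[symmetric] bij_betw_inv_into_left[OF bij] inv_into_into)
  moreover have "inv_into (carrier N) \<psi> ` part M s = part N s" for s
    unfolding part[symmetric]
    by (rule inv_into_image_cancel) (use bij pN in \<open>auto simp: bij_betw_def\<close>)
  ultimately show ?thesis
    unfolding hv_iso_def using N
    by (intro conjI bexI[of _ "inv_into (carrier N) \<psi>"])
      (auto dest!: pre simp: smult[symmetric] act[symmetric] bij_betw_inv_into_left[OF bij]
        N.act_closed C)
qed

section \<open>Linear extension from a basis\<close>

lemma lookup_pm_scale [simp]: "Poly_Mapping.lookup (pm_scale c x) k = c * Poly_Mapping.lookup x k"
  by (simp add: pm_scale_def Poly_Mapping.map.rep_eq when_def)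

lemma keys_pm_scale: "Poly_Mapping.keys (pm_scale c x) \<subseteq> Poly_Mapping.keys x"
  by (auto simp: in_keys_iff)

lemma pm_scale_simps [simp]:
  "pm_scale c (x + y) = pm_scale c x + pm_scale c y"
  "pm_scale (c + d) x = pm_scale c x + pm_scale d x"
  "pm_scale c (pm_scale d x) = pm_scale (c * d) x"
  "pm_scale 1 x = x" "pm_scale 0 x = 0" "pm_scale c 0 = 0"
  by (rule poly_mapping_eqI; simp add: lookup_add algebra_simps)+

lemma pm_scale_sum: "pm_scale c (sum f A) = (\<Sum>a\<in>A. pm_scale c (f a))"
  by (rule poly_mapping_eqI) (simp add: lookup_sum sum_distrib_left)

text \<open>The linear map with prescribed values on a basis.  The bracket and the action on the intermediate
  series are iterated linear extensions, once in each argument.\<close>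

definition lin_ext :: "('k \<Rightarrow> ('i \<Rightarrow>\<^sub>0 complex)) \<Rightarrow> ('k \<Rightarrow>\<^sub>0 complex) \<Rightarrow> ('i \<Rightarrow>\<^sub>0 complex)" where
  "lin_ext F x = (\<Sum>k \<in> Poly_Mapping.keys x. pm_scale (Poly_Mapping.lookup x k) (F k))"

lemma lin_ext_superset:
  assumes "finite A" "Poly_Mapping.keys x \<subseteq> A"
  shows "lin_ext F x = (\<Sum>k\<in>A. pm_scale (Poly_Mapping.lookup x k) (F k))"
  unfolding lin_ext_def
  by (rule sum.mono_neutral_left) (use assms in \<open>auto simp: in_keys_iff\<close>)

lemma lin_ext_add: "lin_ext F (x + y) = lin_ext F x + lin_ext F y"
  using keys_add[of x y]
  by (simp add: lin_ext_superset[of "Poly_Mapping.keys x \<union> Poly_Mapping.keys y"] lookup_add sum.distrib)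

lemma lin_ext_scale: "lin_ext F (pm_scale c x) = pm_scale c (lin_ext F x)"
  using keys_pm_scale[of c x]
  by (simp add: lin_ext_superset[of "Poly_Mapping.keys x"] pm_scale_sum)

lemma lin_ext_zero [simp]: "lin_ext F 0 = 0"
  by (simp add: lin_ext_def)

lemma lin_ext_sum: "lin_ext F (sum f A) = (\<Sum>a\<in>A. lin_ext F (f a))"
  by (induction A rule: infinite_finite_induct) (auto simp: lin_ext_add)

lemma lin_ext_single: "lin_ext F (Poly_Mapping.single k c) = pm_scale c (F k)"
  by (simp add: lin_ext_def)

lemma lin_ext_minus: "lin_ext F (x - y) = lin_ext F x - lin_ext F y"
  using lin_ext_add[of F "x - y" y] by simp

lemma lin_ext_add_fun: "lin_ext (\<lambda>k. F k + F' k) x = lin_ext F x + lin_ext F' x"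
  by (simp add: lin_ext_def sum.distrib)

lemma lin_ext_scale_fun: "lin_ext (\<lambda>k. pm_scale c (F k)) x = pm_scale c (lin_ext F x)"
  by (simp add: lin_ext_def pm_scale_sum mult.commute)

lemma lin_ext_cong:
  "(\<And>k. k \<in> Poly_Mapping.keys x \<Longrightarrow> F k = F' k) \<Longrightarrow> lin_ext F x = lin_ext F' x"
  by (simp add: lin_ext_def)

lemma lin_ext_lin_ext: "lin_ext F (lin_ext F' x) = lin_ext (\<lambda>k. lin_ext F (F' k)) x"
  by (simp add: lin_ext_def[of F'] lin_ext_sum lin_ext_scale) (simp add: lin_ext_def)

text \<open>Needed because the second half of the supercommutator applies its two factors in the opposite
  order.\<close>

lemma lin_ext_swap:
  "lin_ext (\<lambda>j. lin_ext (\<lambda>k. F j k) y) x = lin_ext (\<lambda>k. lin_ext (\<lambda>j. F j k) x) y"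
  unfolding lin_ext_def pm_scale_sum
  by (subst sum.swap) (simp add: mult.commute)

lemma lin_ext_diff_fun: "lin_ext (\<lambda>k. F k - F' k) x = lin_ext F x - lin_ext F' x"
  using lin_ext_add_fun[of "\<lambda>k. F k - F' k" F' x] by simp

lemma hv_bracket_lin_ext: "hv_bracket x y = lin_ext (\<lambda>a. lin_ext (hv_brk a) y) x"
  by (simp add: hv_bracket_def lin_ext_def pm_scale_sum)

lemma lookup_lin_ext:
  "Poly_Mapping.lookup (lin_ext F x) n =
     (\<Sum>k\<in>Poly_Mapping.keys x. Poly_Mapping.lookup x k * Poly_Mapping.lookup (F k) n)"
  by (simp add: lin_ext_def lookup_sum)

text \<open>Every generator of the superalgebra acts on the intermediate series by a weighted shift: each
  coordinate of the image comes from a single coordinate of the argument.\<close>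

lemma lookup_lin_ext_one_source:
  assumes "\<And>k. Poly_Mapping.lookup (F k) n = (if k = k0 then q else 0)"
  shows "Poly_Mapping.lookup (lin_ext F x) n = q * Poly_Mapping.lookup x k0"
  by (simp add: lookup_lin_ext assms if_distrib cong: if_cong)
   (simp add: sum.delta in_keys_iff)

section \<open>The intermediate series is a module\<close>

lemma act_series:
  "act (series a b c) x v = lin_ext (\<lambda>g. lin_ext (series_gen a b c g) v) x"
  by (simp add: series_def make_hv_mod_def module.defs hv_mod.defs lin_ext_def finsum_UNIV)

lemma series_simps [simp]:
  "carrier (series a b c) = UNIV" "add (series a b c) = (+)" "zero (series a b c) = 0"
  "smult (series a b c) = pm_scale"
  by (simp_all add: series_def make_hv_mod_def module.defs hv_mod.defs)

lemma part_series:
  "part (series a b c) s =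
    {v. Poly_Mapping.keys v \<subseteq> (if s = 0 then range Vplus else range Vminus)}"
  by (simp add: series_def make_hv_mod_def module.defs hv_mod.defs)

primrec series_parity :: "series_basis \<Rightarrow> bit" where
  "series_parity (Vplus n) = 0"
| "series_parity (Vminus j) = 1"

lemma part_series_iff:
  "v \<in> part (series a b c) s \<longleftrightarrow> (\<forall>k. series_parity k \<noteq> s \<longrightarrow> Poly_Mapping.lookup v k = 0)"
proof -
  have "k \<in> (if s = 0 then range Vplus else range Vminus) \<longleftrightarrow> series_parity k = s" for k
    by (cases k; cases s) auto
  then show ?thesis
    by (auto simp: part_series subset_iff in_keys_iff simp del: if_split)
qed

lemma a_inv_series [simp]: "\<ominus>\<^bsub>series a b c\<^esub> v = - v"
  by (rule a_inv_UNIV) auto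

lemma a_minus_series [simp]: "v \<ominus>\<^bsub>series a b c\<^esub> w = v - w"
  by (simp add: a_minus_def)

text \<open>The action in coordinates.  For \<open>p = i + 1/2\<close> the index \<open>n - p\<close> is \<open>(n - i - 1) + 1/2\<close>, whereas
  \<open>(j + 1/2) - p\<close> is \<open>j - i\<close>; this accounts for the unsymmetric offsets.\<close>

lemma lookup_series_act:
  "Poly_Mapping.lookup (lin_ext (series_gen a b c (L m)) v) (Vplus n) =
     (c - of_int (n - m) + of_int m * a) * Poly_Mapping.lookup v (Vplus (n - m))"
  "Poly_Mapping.lookup (lin_ext (series_gen a b c (L m)) v) (Vminus j) =
     (c - hf (j - m) + of_int m * (a + 1/2)) * Poly_Mapping.lookup v (Vminus (j - m))"
  "Poly_Mapping.lookup (lin_ext (series_gen a b c (H m)) v) (Vplus n) =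
     b * Poly_Mapping.lookup v (Vplus (n - m))"
  "Poly_Mapping.lookup (lin_ext (series_gen a b c (H m)) v) (Vminus j) =
     b * Poly_Mapping.lookup v (Vminus (j - m))"
  "Poly_Mapping.lookup (lin_ext (series_gen a b c (G i)) v) (Vplus n) =
     (c - hf (n - i - 1) + 2 * hf i * (a + 1/2)) * Poly_Mapping.lookup v (Vminus (n - i - 1))"
  "Poly_Mapping.lookup (lin_ext (series_gen a b c (G i)) v) (Vminus j) =
     1 * Poly_Mapping.lookup v (Vplus (j - i))"
  "Poly_Mapping.lookup (lin_ext (series_gen a b c (Q i)) v) (Vplus n) =
     b * Poly_Mapping.lookup v (Vminus (n - i - 1))"
  by (rule lookup_lin_ext_one_source;
      case_tac k; auto simp: lookup_single when_def)+

lemma lookup_series_act_zero: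
  "Poly_Mapping.lookup (lin_ext (series_gen a b c (Q i)) v) (Vminus j) = 0"
  "lin_ext (series_gen a b c C1) v = 0"
  "lin_ext (series_gen a b c C2) v = 0"
  "lin_ext (series_gen a b c C3) v = 0"
proof -
  have "series_gen a b c C1 k = 0" "series_gen a b c C2 k = 0" "series_gen a b c C3 k = 0" 
    "Poly_Mapping.lookup (series_gen a b c (Q i) k) (Vminus j) = 0" for k
    by (cases k; simp add: lookup_single)+
  then show
    "Poly_Mapping.lookup (lin_ext (series_gen a b c (Q i)) v) (Vminus j) = 0"
    "lin_ext (series_gen a b c C1) v = 0"
    "lin_ext (series_gen a b c C2) v = 0"
    "lin_ext (series_gen a b c C3) v = 0"
    unfolding lookup_lin_ext
    by (simp_all add: lin_ext_def)
qed

lemma series_gen_parity: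
  assumes "v \<in> part (series a b c) t"
  shows "lin_ext (series_gen a b c g) v \<in> part (series a b c) (hv_parity g + t)"
  unfolding part_series_iff
proof (intro allI impI)
  fix k assume "series_parity k \<noteq> hv_parity g + t"
  then show "Poly_Mapping.lookup (lin_ext (series_gen a b c g) v) k = 0"
    using assms unfolding part_series_iff
    by (cases g; cases k; cases t) (auto simp: lookup_series_act lookup_series_act_zero)
qed

text \<open>In coordinates the module law for two basis elements is, for each pair of basis elements and each
  parity, a polynomial identity in the indices and in \<open>a, b, c\<close> times one coordinate of \<open>v\<close>.  The
  sign of the last term is the super sign: two odd elements give an anticommutator.\<close>

lemma series_gen_bracket:
  "lin_ext (\<lambda>g. lin_ext (series_gen a b c g) v) (hv_brk x y) =
     lin_ext (series_gen a b c x) (lin_ext (series_gen a b c y) v) -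
     pm_scale (if hv_parity x = 1 \<and> hv_parity y = 1 then -1 else 1)
       (lin_ext (series_gen a b c y) (lin_ext (series_gen a b c x) v))"
  (is "?l = ?r")
proof (rule poly_mapping_eqI)
  fix k
  show "Poly_Mapping.lookup ?l k = Poly_Mapping.lookup ?r k"
    by (cases x; cases y; cases k;
      simp add: lookup_add lookup_minus lin_ext_add lin_ext_minus lin_ext_single
        lookup_series_act lookup_series_act_zero hf_def;
      simp add: field_simps)
qed

text \<open>By bilinearity the bracket axiom reduces to pairs of basis elements.  The sign in the axiom depends
  only on the parities \<open>s\<close> and \<open>t\<close>, which all basis elements occurring in homogeneous \<open>x\<close> and \<open>y\<close>
  share, so it can be pulled out of the double sum.\<close>

lemma hv_module_series: "hv_module (series a b c)"
proof -
  let ?N = "series a b c"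
  interpret abelian_group ?N by (rule abelian_group_UNIV) auto
  interpret module complex_ring ?N
    by (intro moduleI cring_complex_ring abelian_group_axioms) (auto simp: complex_ring_def)
  show ?thesis
  proof (intro hv_module.intro hv_module_axioms.intro)
    show "module complex_ring ?N" by (rule module_axioms)
    show "submodule (part ?N s) complex_ring ?N" for s
      by (rule submoduleI) (auto simp: part_series_iff lookup_add)
    show "carrier ?N = part ?N 0 <+>\<^bsub>?N\<^esub> part ?N 1"
    proof (intro subset_antisym subsetI)
      fix v :: "series_basis \<Rightarrow>\<^sub>0 complex"
      define pr where "pr s = Poly_Mapping.mapp (\<lambda>k x. if series_parity k = s then x else 0) v" for s
      have lk: "Poly_Mapping.lookup (pr s) k =
          (if series_parity k = s then Poly_Mapping.lookup v k else 0)" for s k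
        by (simp add: pr_def lookup_mapp when_def in_keys_iff)
      have "v = pr 0 + pr 1"
        by (rule poly_mapping_eqI) (simp add: lk lookup_add)
      moreover have "pr s \<in> part ?N s" for s
        by (simp add: part_series_iff lk)
      ultimately show "v \<in> part ?N 0 <+>\<^bsub>?N\<^esub> part ?N 1"
        by (auto simp: set_add_def')
    qed simp
    show "part ?N 0 \<inter> part ?N 1 = {\<zero>\<^bsub>?N\<^esub>}"
    proof -
      have "v = 0" if "v \<in> part ?N 0" "v \<in> part ?N 1" for v
      proof (rule poly_mapping_eqI)
        fix k show "Poly_Mapping.lookup v k = Poly_Mapping.lookup 0 k"
          using that by (cases "series_parity k") (auto simp: part_series_iff)
      qed
      then show ?thesis by (auto simp: part_series_iff)
    qed
    show "act ?N x v \<in> part ?N (s + t)" if "x \<in> hv_part s" "v \<in> part ?N t" for x s v t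
      unfolding part_series_iff act_series lookup_lin_ext[of "\<lambda>g. lin_ext (series_gen a b c g) v"]
    proof (intro allI impI sum.neutral ballI)
      fix k g assume "series_parity k \<noteq> s + t" "g \<in> Poly_Mapping.keys x"
      moreover from this(2) that(1) have "hv_parity g = s" by (auto simp: hv_part_def)
      ultimately have "Poly_Mapping.lookup (lin_ext (series_gen a b c g) v) k = 0"
        using series_gen_parity[OF that(2), of g, unfolded part_series_iff] by blast
      then show "Poly_Mapping.lookup x g * Poly_Mapping.lookup (lin_ext (series_gen a b c g) v) k = 0"
        by simp
    qed
    show "act ?N (hv_bracket x y) v =
        act ?N x (act ?N y v) \<ominus>\<^bsub>?N\<^esub> (if s = 1 \<and> t = 1 then -1 else 1) \<odot>\<^bsub>?N\<^esub> act ?N y (act ?N x v)"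
      (is "_ = _ \<ominus>\<^bsub>?N\<^esub> ?\<sigma> \<odot>\<^bsub>?N\<^esub> _")
      if "x \<in> hv_part s" "y \<in> hv_part t" for x s y t v
    proof -
      let ?g = "\<lambda>k. lin_ext (series_gen a b c k)"
      have "act ?N (hv_bracket x y) v =
          lin_ext (\<lambda>j. lin_ext (\<lambda>k. lin_ext (\<lambda>g. ?g g v) (hv_brk j k)) y) x"
        by (simp add: act_series hv_bracket_lin_ext lin_ext_lin_ext)
      also have "\<dots> = lin_ext (\<lambda>j. lin_ext (\<lambda>k. ?g j (?g k v) - pm_scale ?\<sigma> (?g k (?g j v))) y) x"
        using that by (intro lin_ext_cong) (simp add: series_gen_bracket hv_part_def)
      also have "\<dots> = lin_ext (\<lambda>j. lin_ext (\<lambda>k. ?g j (?g k v)) y) x -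
          pm_scale ?\<sigma> (lin_ext (\<lambda>k. lin_ext (\<lambda>j. ?g k (?g j v)) x) y)"
        by (simp only: lin_ext_diff_fun lin_ext_scale_fun) (subst lin_ext_swap, rule refl)
      finally show ?thesis
        by (simp only: act_series lin_ext_lin_ext a_minus_series series_simps)
    qed
  qed (simp_all add: act_series lin_ext_add lin_ext_scale lin_ext_add_fun lin_ext_scale_fun)
qed

section \<open>The index set of the weights\<close>

text \<open>The weight of the family member \<open>v\<^sup>+\<close> or \<open>v\<^sup>-\<close>; it identifies the basis of the intermediate series
  with \<open>\<int> \<union> (\<int> + 1/2)\<close>.\<close>

primrec idx :: "series_basis \<Rightarrow> complex" where
  "idx (Vplus n) = of_int n"
| "idx (Vminus j) = hf j"

lemma hf_not_int [simp]: "hf j \<notin> \<int>"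
proof
  assume "hf j \<in> \<int>"
  then obtain k where "hf j = of_int k" by (elim Ints_cases)
  then have "of_int (2 * j + 1) = (of_int (2 * k) :: complex)"
    by (simp add: hf_def field_simps)
  then have "2 * j + 1 = 2 * k" by (simp only: of_int_eq_iff)
  then show False by presburger
qed

lemma hf_neq_of_int [simp]: "hf j \<noteq> of_int n" "of_int n \<noteq> hf j"
  using hf_not_int[of j] by (metis Ints_of_int)+

lemma hf_inject [simp]: "hf i = hf j \<longleftrightarrow> i = j"
  by (simp add: hf_def)

lemma index_parity_idx [simp]: "index_parity (idx k) = series_parity k"
  by (cases k) (auto simp: index_parity_def)

lemma idx_inject [simp]: "idx k = idx k' \<longleftrightarrow> k = k'"
  by (cases k; cases k') simp_all

lemma half_ints_eq: "half_ints = range idx"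
proof (intro subset_antisym subsetI)
  fix r assume "r \<in> half_ints"
  then obtain k where k: "2 * r = of_int k" by (auto simp: half_ints_def elim: Ints_cases)
  show "r \<in> range idx"
  proof (cases "even k")
    case True
    then obtain n where "k = 2 * n" by (elim evenE)
    then have "r = idx (Vplus n)" using k by simp
    then show ?thesis by blast
  next
    case False
    then obtain j where "k = 2 * j + 1" by (elim oddE)
    then have "r = idx (Vminus j)" using k by (simp add: hf_def field_simps)
    then show ?thesis by blast
  qed
next
  fix r assume "r \<in> range idx"
  then obtain k where "r = idx k" by blast
  then have "2 * r = of_int (case k of Vplus n \<Rightarrow> 2 * n | Vminus j \<Rightarrow> 2 * j + 1)"
    by (cases k) (auto simp: hf_def)
  then show "r \<in> half_ints" unfolding half_ints_def by (simp only: mem_Collect_eq Ints_of_int)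
qed

lemma idx_in_half_ints [simp]: "idx k \<in> half_ints"
  by (simp add: half_ints_eq)

section \<open>The weight submodules of \<open>\<Omega>'\<close>\<close>

text \<open>Evaluation at the common zero \<open>L\<^sub>0 = -(r + \<alpha>\<^sub>1)\<close>, \<open>H\<^sub>0 = -\<alpha>\<^sub>2\<close> of the generators of the maximal ideal of
  index \<open>r\<close>.  It is a ring homomorphism whose kernel is that ideal.\<close>

definition ev :: "complex \<times> complex \<Rightarrow> complex \<Rightarrow> complex poly poly \<Rightarrow> complex" where
  "ev \<alpha> r f = poly (poly f [:- (r + fst \<alpha>):]) (- snd \<alpha>)"

lemma ev_simps [simp]:
  "ev \<alpha> r (f + g) = ev \<alpha> r f + ev \<alpha> r g" "ev \<alpha> r (f * g) = ev \<alpha> r f * ev \<alpha> r g"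
  "ev \<alpha> r 0 = 0" "ev \<alpha> r 1 = 1" "ev \<alpha> r (- f) = - ev \<alpha> r f"
  "ev \<alpha> r (f - g) = ev \<alpha> r f - ev \<alpha> r g"
  "ev \<alpha> r (cst c) = c" "ev \<alpha> r [:b:] = poly b (- snd \<alpha>)"
  "ev \<alpha> r L0 = - (r + fst \<alpha>)" "ev \<alpha> r H0 = - snd \<alpha>"
  "ev \<alpha> r (Polynomial.smult b f) = poly b (- snd \<alpha>) * ev \<alpha> r f"
  by (simp_all add: ev_def cst_def L0_def H0_def)

text \<open>The shift in the action of an element of degree \<open>k\<close> cancels the change of the evaluation point
  from index \<open>r - k\<close> to index \<open>r\<close>; this makes the action on the quotients well defined.\<close>

lemma ev_shift [simp]: "ev \<alpha> r (shift k f) = ev \<alpha> (r - k) f"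
  by (simp add: ev_def shift_def poly_pcompose L0_def cst_def algebra_simps)

text \<open>The Nullstellensatz at one point, by dividing twice: first by the linear factor in \<open>L\<^sub>0\<close>, then the
  remainder, a polynomial in \<open>H\<^sub>0\<close>, by the linear factor in \<open>H\<^sub>0\<close>.\<close>

lemma wt_ideal_eq: "wt_ideal \<alpha> r = {f. ev \<alpha> r f = 0}"
proof (intro subset_antisym subsetI)
  fix f assume "f \<in> {f. ev \<alpha> r f = 0}"
  define c where "c = [:- (r + fst \<alpha>):]"
  have "poly (f - [:poly f c:]) c = 0" by simp
  then obtain u where u: "f - [:poly f c:] = [:- c, 1:] * u"
    unfolding poly_eq_0_iff_dvd by (elim dvdE)
  have "poly (poly f c) (- snd \<alpha>) = 0"
    using \<open>f \<in> _\<close> by (simp add: ev_def c_def)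
  then obtain w where w: "poly f c = [:snd \<alpha>, 1:] * w"
    unfolding poly_eq_0_iff_dvd by (auto elim: dvdE)
  have "f = [:- c, 1:] * u + [:[:snd \<alpha>, 1:] * w:]"
    using u w by (simp add: algebra_simps)
  also have "\<dots> = u * (L0 + cst (r + fst \<alpha>)) + [:w:] * (H0 + cst (snd \<alpha>))"
    by (simp add: L0_def H0_def cst_def c_def add.commute)
  finally show "f \<in> wt_ideal \<alpha> r" unfolding wt_ideal_def by blast
qed (auto simp: wt_ideal_def)

lemma Omega_simps [simp]:
  "carrier (Omega l b) = UNIV" "add (Omega l b) = (+)" "zero (Omega l b) = 0"
  "smult (Omega l b) = (\<lambda>c (f, g). (cst c * f, cst c * g))"
  "part (Omega l b) s = (if s = 0 then UNIV \<times> {0} else {0} \<times> UNIV)"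
  by (simp_all add: Omega_def make_hv_mod_def module.defs hv_mod.defs)

lemma act_Omega_single: "act (Omega l b) (Poly_Mapping.single a 1) v = Omega_gen l b a v"
  by (simp add: Omega_def make_hv_mod_def module.defs hv_mod.defs finsum_UNIV split: prod.split)
    (simp add: cst_def flip: one_pCons)

lemma shift_0 [simp]: "shift 0 f = f"
  by (simp add: shift_def L0_def cst_def pcompose_idR)

lemma cst_0 [simp]: "cst 0 = 0" and cst_1 [simp]: "cst 1 = 1"
  by (simp_all add: cst_def flip: one_pCons)

text \<open>On both summands \<open>L\<^sub>0\<close> and \<open>H\<^sub>0\<close> act as multiplication by the variables, since the shift by degree
  \<open>0\<close> and the factor \<open>m = 0\<close> disappear; hence \<open>U(\<hh>)\<close> acts by multiplication.\<close>

lemma Uh_act_Omega: "Uh_act (Omega l b) u (f, g) = (u * f, u * g)"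
proof -
  have L: "(act (Omega l b) (Poly_Mapping.single (L 0) 1) ^^ i) (f, g) = (L0 ^ i * f, L0 ^ i * g)"
    for i f g
    by (induction i) (auto simp: act_Omega_single algebra_simps)
  have H: "(act (Omega l b) (Poly_Mapping.single (H 0) 1) ^^ i) (f, g) = (H0 ^ i * f, H0 ^ i * g)"
    for i f g
    by (induction i) (auto simp: act_Omega_single algebra_simps)
  have S: "(\<Sum>i\<in>A. (F i, K i)) = (sum F A, sum K A)"
    for A :: "nat set" and F K :: "nat \<Rightarrow> complex poly poly"
    by (induction A rule: infinite_finite_induct) (auto simp: zero_prod_def)
  (* The sum over j collects the powers of H0 into the coefficient p of L0 ^ i. *)
  have inner: "(\<Sum>j\<le>degree p. cst (coeff p j) * (L0 ^ i * (H0 ^ j * h))) = monom p i * h" for p i h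
  proof -
    have "(\<Sum>j\<le>degree p. cst (coeff p j) * H0 ^ j) = [:\<Sum>j\<le>degree p. monom (coeff p j) j:]"
    proof -
      have "H0 ^ j = [:monom 1 j:]" for j
        by (simp add: H0_def poly_const_pow monom_altdef)
      moreover have "(\<Sum>j\<in>A. [:F j:]) = [:sum F A:]"
        for A :: "nat set" and F :: "nat \<Rightarrow> complex poly"
        by (induction A rule: infinite_finite_induct) auto
      ultimately show ?thesis
        by (simp add: cst_def smult_monom)
    qed
    then have "(\<Sum>j\<le>degree p. cst (coeff p j) * H0 ^ j) = [:p:]"
      by (simp add: poly_as_sum_of_monoms)
    moreover have "L0 ^ i * [:p:] = monom p i"
      by (simp add: L0_def monom_altdef[of p]) 
    moreover have "(\<Sum>j\<le>degree p. cst (coeff p j) * (L0 ^ i * (H0 ^ j * h))) =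
        L0 ^ i * (\<Sum>j\<le>degree p. cst (coeff p j) * H0 ^ j) * h"
      by (simp add: sum_distrib_left sum_distrib_right mult_ac)
    ultimately show ?thesis by simp
  qed
  show ?thesis
    by (simp add: Uh_act_def finsum_UNIV L H S inner sum_distrib_right[symmetric] poly_as_sum_of_monoms)
qed

text \<open>The fibre of the evaluation map over the pair \<open>x\<close>: the cosets of the weight submodule of index
  \<open>r\<close> are exactly these fibres, so the quotient becomes \<open>\<complex> \<times> \<complex>\<close> with even and odd coordinate.\<close>

definition level ::
  "complex \<times> complex \<Rightarrow> complex \<Rightarrow> complex \<times> complex \<Rightarrow> (complex poly poly \<times> complex poly poly) set" where
  "level \<alpha> r x = {(f, g). ev \<alpha> r f = fst x \<and> ev \<alpha> r g = snd x}"

lemma wt_sub_Omega: "wt_sub \<alpha> (Omega l b) r = level \<alpha> r 0"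
proof -
  let ?M = "Omega l b"
  let ?H = "{Uh_act ?M u v |u v. u \<in> wt_ideal \<alpha> r \<and> v \<in> carrier ?M}"
  interpret abelian_group ?M by (rule abelian_group_UNIV) auto
  have neg: "inv\<^bsub>add_monoid ?M\<^esub> v = - v" for v
    using a_inv_UNIV[of ?M v] by (simp add: a_inv_def)
  have sub: "subgroup (level \<alpha> r 0) (add_monoid ?M)"
    by (rule subgroup.intro; (simp only: neg)?) (auto simp: level_def zero_prod_def)
  have "generate (add_monoid ?M) ?H \<subseteq> level \<alpha> r 0"
    by (rule add.generate_subgroup_incl[OF _ sub])
      (auto simp: level_def wt_ideal_eq Uh_act_Omega)
  moreover have "(f, g) \<in> generate (add_monoid ?M) ?H" if "(f, g) \<in> level \<alpha> r 0" for f g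
  proof -
    have "(f, 0) \<in> ?H"
      using that
      by (intro CollectI exI[of _ f] exI[of _ "(1, 0)"]) (simp add: level_def wt_ideal_eq Uh_act_Omega)
    moreover have "(0, g) \<in> ?H"
      using that
      by (intro CollectI exI[of _ g] exI[of _ "(0, 1)"]) (simp add: level_def wt_ideal_eq Uh_act_Omega)
    ultimately have "(f, 0) \<otimes>\<^bsub>add_monoid ?M\<^esub> (0, g) \<in> generate (add_monoid ?M) ?H"
      by (intro generate.eng generate.incl)
    then show ?thesis by simp
  qed
  ultimately show ?thesis
    by (auto simp: wt_sub_def)
qed

section \<open>Cosets as fibres of the evaluation map\<close>

text \<open>Every fibre is nonempty because it contains a pair of constant polynomials.\<close>

lemma level_witness: "(cst (fst x), cst (snd x)) \<in> level \<alpha> r x"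
  by (simp add: level_def)

lemma level_inject [simp]: "level \<alpha> r x = level \<alpha> r y \<longleftrightarrow> x = y"
proof
  assume "level \<alpha> r x = level \<alpha> r y"
  then have "(cst (fst x), cst (snd x)) \<in> level \<alpha> r y" using level_witness by blast
  then show "x = y" by (auto simp: level_def prod_eq_iff)
qed simp

lemma level_set_add:
  "level \<alpha> r x <+>\<^bsub>Omega l b\<^esub> level \<alpha> r y = level \<alpha> r (x + y)"
proof (intro subset_antisym subsetI)
  fix v assume "v \<in> level \<alpha> r (x + y)"
  moreover define w where "w = (cst (fst x), cst (snd x))"
  ultimately have "v - w \<in> level \<alpha> r y" by (auto simp: level_def)
  moreover have "w \<in> level \<alpha> r x" unfolding w_def by (rule level_witness)
  moreover have "v = w + (v - w)" by simp
  ultimately show "v \<in> level \<alpha> r x <+>\<^bsub>Omega l b\<^esub> level \<alpha> r y"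
    by (simp only: set_add_def' Omega_simps) blast
qed (auto simp: set_add_def' level_def)

text \<open>A fibre is a coset of the zero fibre, so a single image point together with the zero fibre already
  fills the fibre in which it lies.  This computes scalar multiples and the action on cosets.\<close>

lemma level_image:
  assumes "\<And>v. v \<in> level \<alpha> r' x \<Longrightarrow> h v \<in> level \<alpha> r y"
  shows "level \<alpha> r 0 <+>\<^bsub>Omega l b\<^esub> (h ` level \<alpha> r' x) = level \<alpha> r y"
proof (intro subset_antisym subsetI)
  fix v assume v: "v \<in> level \<alpha> r y"
  define w where "w = h (cst (fst x), cst (snd x))"
  have "w \<in> h ` level \<alpha> r' x" unfolding w_def by (intro imageI level_witness)
  moreover have "v - w \<in> level \<alpha> r 0"
    using v assms[OF level_witness] by (auto simp: level_def w_def)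
  moreover have "v = (v - w) + w" by simp
  ultimately show "v \<in> level \<alpha> r 0 <+>\<^bsub>Omega l b\<^esub> (h ` level \<alpha> r' x)"
    by (simp only: set_add_def' Omega_simps) blast
next
  fix v assume "v \<in> level \<alpha> r 0 <+>\<^bsub>Omega l b\<^esub> (h ` level \<alpha> r' x)"
  then obtain u w where "u \<in> level \<alpha> r 0" "w \<in> level \<alpha> r' x" "v = u + h w"
    by (auto simp: set_add_def')
  then show "v \<in> level \<alpha> r y"
    using assms[of w] by (auto simp: level_def)
qed

lemma level_coset:
  "level \<alpha> r 0 +>\<^bsub>Omega l b\<^esub> (f, g) = level \<alpha> r (ev \<alpha> r f, ev \<alpha> r g)"
proof (intro subset_antisym subsetI)
  fix v assume "v \<in> level \<alpha> r (ev \<alpha> r f, ev \<alpha> r g)"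
  then have "v - (f, g) \<in> level \<alpha> r 0" by (auto simp: level_def)
  moreover have "v = v - (f, g) + (f, g)" by simp
  ultimately show "v \<in> level \<alpha> r 0 +>\<^bsub>Omega l b\<^esub> (f, g)"
    by (simp only: a_r_coset_def' Omega_simps) blast
qed (auto simp: a_r_coset_def' level_def)

definition place :: "bit \<Rightarrow> complex \<Rightarrow> complex \<times> complex" where
  "place s z = (if s = 0 then (z, 0) else (0, z))"

lemma place_zero [simp]: "place s 0 = 0" and place_inject [simp]: "place s y = place s z \<longleftrightarrow> y = z"
  and place_eq_zero [simp]: "place s y = 0 \<longleftrightarrow> y = 0"
  by (auto simp: place_def zero_prod_def)

lemma place_other_parity: "(\<exists>z. place t y = place s z) \<longleftrightarrow> (t \<noteq> s \<longrightarrow> y = 0)"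
  by (cases s; cases t) (auto simp: place_def)

lemma rcosets_Omega: "a_rcosets\<^bsub>Omega l b\<^esub> (wt_sub \<alpha> (Omega l b) r) = range (level \<alpha> r)"
proof -
  have "a_rcosets\<^bsub>Omega l b\<^esub> (wt_sub \<alpha> (Omega l b) r) =
      range (\<lambda>(f, g). level \<alpha> r (ev \<alpha> r f, ev \<alpha> r g))"
    unfolding A_RCOSETS_def' wt_sub_Omega
    by (simp add: level_coset[where l = l and b = b, symmetric] UNION_singleton_eq_range)
  also have "\<dots> = range (level \<alpha> r)"
  proof (intro subset_antisym subsetI)
    fix S assume "S \<in> range (level \<alpha> r)"
    then obtain x where "S = level \<alpha> r x" by blast
    then show "S \<in> range (\<lambda>(f, g). level \<alpha> r (ev \<alpha> r f, ev \<alpha> r g))"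
      by (intro image_eqI[of _ _ "(cst (fst x), cst (snd x))"]) simp_all
  qed auto
  finally show ?thesis .
qed

lemma homogeneous_coset_Omega:
  "(\<exists>v \<in> part (Omega l b) s. S = level \<alpha> r 0 +>\<^bsub>Omega l b\<^esub> v) \<longleftrightarrow> (\<exists>z. S = level \<alpha> r (place s z))"
proof
  assume "\<exists>z. S = level \<alpha> r (place s z)"
  then obtain z where z: "S = level \<alpha> r (place s z)" by blast
  show "\<exists>v \<in> part (Omega l b) s. S = level \<alpha> r 0 +>\<^bsub>Omega l b\<^esub> v"
    by (rule bexI[of _ "if s = 0 then (cst z, 0) else (0, cst z)"])
      (auto simp: z level_coset place_def)
qed (auto simp: level_coset place_def split: if_splits)

lemma full_space_simps [simp]:
  "carrier (full_weighting_space \<alpha> (Omega l b)) = {w \<in> \<Pi>\<^sub>E r \<in> half_ints. range (level \<alpha> r).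
      finite {r \<in> half_ints. w r \<noteq> level \<alpha> r 0}}"
  "zero (full_weighting_space \<alpha> (Omega l b)) = (\<lambda>r \<in> half_ints. level \<alpha> r 0)"
  "add (full_weighting_space \<alpha> (Omega l b)) = (\<lambda>w w'. \<lambda>r \<in> half_ints. w r <+>\<^bsub>Omega l b\<^esub> w' r)"
  "smult (full_weighting_space \<alpha> (Omega l b)) = (\<lambda>c w. \<lambda>r \<in> half_ints.
      level \<alpha> r 0 <+>\<^bsub>Omega l b\<^esub> ((\<lambda>v. c \<odot>\<^bsub>Omega l b\<^esub> v) ` w r))"
  by (simp_all add: full_weighting_space_def rcosets_Omega[unfolded wt_sub_Omega] wt_sub_Omega
      del: Omega_simps)

text \<open>The finite sums that define the action are computed in the full space, so it has to be known that
  addition of families of cosets is associative and commutative there.\<close>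

lemma abelian_monoid_full_space: "abelian_monoid (full_weighting_space \<alpha> (Omega l b))"
  (is "abelian_monoid ?F")
proof (rule abelian_monoidI)
  have lev: "\<exists>x. w r = level \<alpha> r x" if "w \<in> carrier ?F" "r \<in> half_ints" for w r
    using that by (auto dest: PiE_mem)
  have ext: "w \<in> extensional half_ints" if "w \<in> carrier ?F" for w
    using that by (auto simp: PiE_def)
  show "w \<oplus>\<^bsub>?F\<^esub> w' \<in> carrier ?F" if w: "w \<in> carrier ?F" "w' \<in> carrier ?F" for w w'
  proof -
    have *: "\<exists>x. w r <+>\<^bsub>Omega l b\<^esub> w' r = level \<alpha> r x" if "r \<in> half_ints" for r
      using lev[OF w(1) that] lev[OF w(2) that] by (auto simp: level_set_add)
    have "{r \<in> half_ints. (w \<oplus>\<^bsub>?F\<^esub> w') r \<noteq> level \<alpha> r 0} \<subseteq>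
        {r \<in> half_ints. w r \<noteq> level \<alpha> r 0} \<union> {r \<in> half_ints. w' r \<noteq> level \<alpha> r 0}"
      by (auto simp: level_set_add)
    moreover have "finite \<dots>" using w by auto
    ultimately have "finite {r \<in> half_ints. (w \<oplus>\<^bsub>?F\<^esub> w') r \<noteq> level \<alpha> r 0}"
      by (rule finite_subset)
    with * show ?thesis by (auto simp: image_iff)
  qed
  show "\<zero>\<^bsub>?F\<^esub> \<in> carrier ?F"
    by auto
  show "(x \<oplus>\<^bsub>?F\<^esub> y) \<oplus>\<^bsub>?F\<^esub> z = x \<oplus>\<^bsub>?F\<^esub> (y \<oplus>\<^bsub>?F\<^esub> z)"
    if mem: "x \<in> carrier ?F" "y \<in> carrier ?F" "z \<in> carrier ?F" for x y z
  proof (rule extensionalityI[of _ half_ints])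
    fix r assume r: "r \<in> half_ints"
    show "((x \<oplus>\<^bsub>?F\<^esub> y) \<oplus>\<^bsub>?F\<^esub> z) r = (x \<oplus>\<^bsub>?F\<^esub> (y \<oplus>\<^bsub>?F\<^esub> z)) r"
    proof -
      obtain a b c where "x r = level \<alpha> r a" "y r = level \<alpha> r b" "z r = level \<alpha> r c"
        using lev[OF mem(1) r] lev[OF mem(2) r] lev[OF mem(3) r] by blast
      then show ?thesis using r by (simp add: level_set_add add.assoc)
    qed
  qed auto
  show "\<zero>\<^bsub>?F\<^esub> \<oplus>\<^bsub>?F\<^esub> x = x" if mem: "x \<in> carrier ?F" for x
  proof (rule extensionalityI[of _ half_ints])
    fix r assume r: "r \<in> half_ints"
    show "(\<zero>\<^bsub>?F\<^esub> \<oplus>\<^bsub>?F\<^esub> x) r = x r"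
    proof -
      obtain a where "x r = level \<alpha> r a" using lev[OF mem r] by blast
      then show ?thesis using r by (simp add: level_set_add)
    qed
  qed (use ext[OF mem] in simp_all)
  show "x \<oplus>\<^bsub>?F\<^esub> y = y \<oplus>\<^bsub>?F\<^esub> x" if mem: "x \<in> carrier ?F" "y \<in> carrier ?F" for x y
  proof (rule extensionalityI[of _ half_ints])
    fix r assume r: "r \<in> half_ints"
    show "(x \<oplus>\<^bsub>?F\<^esub> y) r = (y \<oplus>\<^bsub>?F\<^esub> x) r"
    proof -
      obtain a b where "x r = level \<alpha> r a" "y r = level \<alpha> r b"
        using lev[OF mem(1) r] lev[OF mem(2) r] by blast
      then show ?thesis using r by (simp add: level_set_add add.commute)
    qed
  qed auto
qed

section \<open>The isomorphism\<close>

lemma full_weighting_simps: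
  "carrier (full_weighting \<alpha> M) = carrier (full_weighting_space \<alpha> M)"
  "add (full_weighting \<alpha> M) = add (full_weighting_space \<alpha> M)"
  "zero (full_weighting \<alpha> M) = zero (full_weighting_space \<alpha> M)"
  "smult (full_weighting \<alpha> M) = smult (full_weighting_space \<alpha> M)"
  "part (full_weighting \<alpha> M) s = {w \<in> carrier (full_weighting_space \<alpha> M).
      \<forall>r \<in> half_ints. \<exists>v \<in> part M s. w r = wt_sub \<alpha> M r +>\<^bsub>M\<^esub> v}"
  "act (full_weighting \<alpha> M) x w = finsum (full_weighting_space \<alpha> M)
      (\<lambda>a. Poly_Mapping.lookup x a \<odot>\<^bsub>full_weighting_space \<alpha> M\<^esub> weighting_gen \<alpha> M a w)
      (Poly_Mapping.keys x)"
  by (simp_all add: full_weighting_def make_hv_mod_def module.defs hv_mod.defs)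

lemma weighting_simps:
  "add (weighting \<alpha> M) = add (full_weighting_space \<alpha> M)"
  "zero (weighting \<alpha> M) = zero (full_weighting_space \<alpha> M)"
  "smult (weighting \<alpha> M) = smult (full_weighting_space \<alpha> M)"
  "act (weighting \<alpha> M) x w = act (full_weighting \<alpha> M) x w"
  "part (weighting \<alpha> M) s = part (full_weighting \<alpha> M) s \<inter> carrier (weighting \<alpha> M)"
  "carrier (weighting \<alpha> M) = {w \<in> carrier (full_weighting_space \<alpha> M). \<forall>r \<in> half_ints.
      \<exists>v \<in> part M (index_parity r). w r = wt_sub \<alpha> M r +>\<^bsub>M\<^esub> v}"
  by (simp_all add: weighting_def Let_def full_weighting_simps)

text \<open>In the weighting module the coordinate whose parity disagrees with the index vanishes, so an
  element is a finitely supported family of single complex numbers, one for each basis vector of the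
  intermediate series.\<close>

lemma in_carrier_weighting_Omega:
  "w \<in> carrier (weighting \<alpha> (Omega l b)) \<longleftrightarrow>
     w \<in> extensional half_ints \<and>
     (\<forall>k. \<exists>z. w (idx k) = level \<alpha> (idx k) (place (series_parity k) z)) \<and>
     finite {k. w (idx k) \<noteq> level \<alpha> (idx k) 0}"
proof -
  have "{r \<in> half_ints. w r \<noteq> level \<alpha> r 0} = idx ` {k. w (idx k) \<noteq> level \<alpha> (idx k) 0}"
    by (auto simp: half_ints_eq)
  then have "finite {r \<in> half_ints. w r \<noteq> level \<alpha> r 0} \<longleftrightarrow> finite {k. w (idx k) \<noteq> level \<alpha> (idx k) 0}"
    by (simp add: finite_image_iff inj_on_def)
  moreover have "w \<in> (\<Pi>\<^sub>E r \<in> half_ints. range (level \<alpha> r)) \<longleftrightarrow>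
      w \<in> extensional half_ints \<and> (\<forall>k. w (idx k) \<in> range (level \<alpha> (idx k)))"
    by (auto simp: half_ints_eq PiE_def Pi_def)
  ultimately show ?thesis
    unfolding weighting_simps(6) wt_sub_Omega homogeneous_coset_Omega full_space_simps mem_Collect_eq
    by (simp only: half_ints_eq ball_simps index_parity_idx image_iff Bex_def) blast
qed

text \<open>The rescaling that removes the powers of \<open>\<lambda>\<close>.  The action of \<open>\<Omega>'\<close> produces \<open>\<lambda>\<^bsup>m\<^esup>\<close> for \<open>L\<^sub>m, H\<^sub>m\<close>,
  \<open>\<lambda>\<^bsup>i\<^esup>\<close> for \<open>G\<close> from even to odd and \<open>\<lambda>\<^bsup>i + 1\<^esup>\<close> for \<open>G, Q\<close> from odd to even, where \<open>p = i + 1/2\<close>; in each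
  case this is the quotient of the twists of the target and of the source index, the odd index
  \<open>j + 1/2\<close> being twisted by \<open>\<lambda>\<^bsup>j\<^esup>\<close>.\<close>

primrec twist :: "complex \<Rightarrow> series_basis \<Rightarrow> complex" where
  "twist l (Vplus n) = l powi n"
| "twist l (Vminus j) = l powi j"

lemma twist_nonzero [simp]: "l \<noteq> 0 \<Longrightarrow> twist l k \<noteq> 0"
  by (cases k) auto

text \<open>The isomorphism from the intermediate series to the weighting module: the component of index \<open>r\<close>
  is the coset on which evaluation gives the rescaled coordinate of \<open>v\<close>.\<close>

definition coset_family :: "complex \<times> complex \<Rightarrow> complex \<Rightarrow> (series_basis \<Rightarrow>\<^sub>0 complex) \<Rightarrow>
    complex \<Rightarrow> (complex poly poly \<times> complex poly poly) set" where
  "coset_family \<alpha> l v = (\<lambda>r \<in> half_ints. level \<alpha> r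
     (let k = inv_into UNIV idx r
      in place (index_parity r) (twist l k * Poly_Mapping.lookup v k)))"

lemma coset_family_idx [simp]:
  "coset_family \<alpha> l v (idx k) =
     level \<alpha> (idx k) (place (series_parity k) (twist l k * Poly_Mapping.lookup v k))"
  by (simp add: coset_family_def inv_f_f inj_on_def)

lemma coset_family_extensional [simp]: "coset_family \<alpha> l v \<in> extensional half_ints"
  by (simp add: coset_family_def)

lemma half_ints_family_eqI:
  assumes "w \<in> extensional half_ints" "w' \<in> extensional half_ints" "\<And>k. w (idx k) = w' (idx k)"
  shows "w = w'"
  by (rule extensionalityI[OF assms(1,2)]) (use assms(3) in \<open>auto simp: half_ints_eq\<close>)

lemma coset_family_in_carrier: "coset_family \<alpha> l v \<in> carrier (weighting \<alpha> (Omega l b))"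
proof -
  have "{k. coset_family \<alpha> l v (idx k) \<noteq> level \<alpha> (idx k) 0} \<subseteq> Poly_Mapping.keys v"
    by (auto simp: in_keys_iff)
  then show ?thesis
    unfolding in_carrier_weighting_Omega by (auto intro: finite_subset)
qed

lemma bij_betw_coset_family:
  assumes "l \<noteq> 0"
  shows "bij_betw (coset_family \<alpha> l) UNIV (carrier (weighting \<alpha> (Omega l b)))"
proof (rule bij_betw_imageI)
  show "inj (coset_family \<alpha> l)"
  proof (rule injI, rule poly_mapping_eqI)
    fix v v' k assume "coset_family \<alpha> l v = coset_family \<alpha> l v'"
    then have "coset_family \<alpha> l v (idx k) = coset_family \<alpha> l v' (idx k)" by simp
    then show "Poly_Mapping.lookup v k = Poly_Mapping.lookup v' k"
      using assms by simp
  qed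
  have "w \<in> range (coset_family \<alpha> l)" if "w \<in> carrier (weighting \<alpha> (Omega l b))" for w
  proof -
    from that obtain z
      where z: "\<And>k. w (idx k) = level \<alpha> (idx k) (place (series_parity k) (z k))"
        and fin: "finite {k. w (idx k) \<noteq> level \<alpha> (idx k) 0}"
        and ext: "w \<in> extensional half_ints"
      unfolding in_carrier_weighting_Omega by metis
    define v where "v = Abs_poly_mapping (\<lambda>k. z k / twist l k)"
    have "finite {k. z k / twist l k \<noteq> 0}"
      using fin assms by (simp add: z)
    then have "Poly_Mapping.lookup v k = z k / twist l k" for k
      by (simp add: v_def)
    then have "w = coset_family \<alpha> l v"
      using assms by (intro half_ints_family_eqI ext) (simp_all add: z)
    then show ?thesis by blast
  qed
  then show "range (coset_family \<alpha> l) = carrier (weighting \<alpha> (Omega l b))"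
    using coset_family_in_carrier by blast
qed

lemma coset_family_zero:
  "coset_family \<alpha> l 0 = \<zero>\<^bsub>full_weighting_space \<alpha> (Omega l b)\<^esub>"
  by (rule half_ints_family_eqI) simp_all

lemma coset_family_add:
  "coset_family \<alpha> l (v + w) =
     coset_family \<alpha> l v \<oplus>\<^bsub>full_weighting_space \<alpha> (Omega l b)\<^esub> coset_family \<alpha> l w"
proof (rule half_ints_family_eqI)
  have *: "place s (x + y) = place s x + place s y" for s x y
    by (simp add: place_def)
  show "coset_family \<alpha> l (v + w) (idx k) =
     (coset_family \<alpha> l v \<oplus>\<^bsub>full_weighting_space \<alpha> (Omega l b)\<^esub> coset_family \<alpha> l w) (idx k)" for k
    by (simp add: level_set_add lookup_add * algebra_simps)
qed simp_all

lemma coset_family_scale: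
  "coset_family \<alpha> l (pm_scale c v) =
     c \<odot>\<^bsub>full_weighting_space \<alpha> (Omega l b)\<^esub> coset_family \<alpha> l v"
proof (rule half_ints_family_eqI)
  show "coset_family \<alpha> l (pm_scale c v) (idx k) =
     (c \<odot>\<^bsub>full_weighting_space \<alpha> (Omega l b)\<^esub> coset_family \<alpha> l v) (idx k)" for k
    unfolding full_space_simps coset_family_idx
    by (simp del: Omega_simps(2), rule sym, rule level_image) (auto simp: level_def place_def)
qed simp_all

lemma coset_family_sum:
  "coset_family \<alpha> l (sum f A) =
     finsum (full_weighting_space \<alpha> (Omega l b)) (\<lambda>a. coset_family \<alpha> l (f a)) A"
proof -
  interpret abelian_monoid "full_weighting_space \<alpha> (Omega l b)"
    by (rule abelian_monoid_full_space)
  have "coset_family \<alpha> l v \<in> carrier (full_weighting_space \<alpha> (Omega l b))" for v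
    using coset_family_in_carrier[of \<alpha> l v b] unfolding weighting_simps(6) by blast
  then show ?thesis
    by (induction A rule: infinite_finite_induct)
      (auto simp: coset_family_zero[of _ _ b] coset_family_add[of _ _ _ _ b]
        finsum_infinite finsum_insert simp del: full_space_simps)
qed

text \<open>A component that is represented both by a vector of parity \<open>s\<close> and by one of the parity of its index
  is zero when the two parities differ, so homogeneity is a condition on the support.\<close>

lemma part_weighting_Omega:
  assumes "l \<noteq> 0"
  shows "coset_family \<alpha> l ` part (series a b c) s = part (weighting \<alpha> (Omega l \<beta>)) s"
proof -
  have "coset_family \<alpha> l v \<in> part (weighting \<alpha> (Omega l \<beta>)) s \<longleftrightarrow> v \<in> part (series a b c) s" for v
  proof -
    have "coset_family \<alpha> l v \<in> carrier (full_weighting_space \<alpha> (Omega l \<beta>))"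
      using coset_family_in_carrier[of \<alpha> l v \<beta>] unfolding weighting_simps(6) by blast
    then show ?thesis
      using assms coset_family_in_carrier[of \<alpha> l v \<beta>]
      unfolding weighting_simps(5) full_weighting_simps wt_sub_Omega homogeneous_coset_Omega
        part_series_iff
      by (simp add: half_ints_eq place_other_parity del: full_space_simps)
  qed
  moreover have "part (weighting \<alpha> (Omega l \<beta>)) s \<subseteq> range (coset_family \<alpha> l)"
    using bij_betw_coset_family[OF assms, of \<alpha> \<beta>] by (auto simp: bij_betw_def weighting_simps(5))
  ultimately show ?thesis by (simp add: set_eq_iff image_iff subset_iff) metis
qed

text \<open>The basis index from which an element of the given degree reaches the index \<open>k\<close>.  For the central
  elements the degree is zero.\<close>

fun source :: "hv_basis \<Rightarrow> series_basis \<Rightarrow> series_basis" where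
  "source (L m) (Vplus n) = Vplus (n - m)"
| "source (L m) (Vminus j) = Vminus (j - m)"
| "source (H m) (Vplus n) = Vplus (n - m)"
| "source (H m) (Vminus j) = Vminus (j - m)"
| "source (G i) (Vplus n) = Vminus (n - i - 1)"
| "source (G i) (Vminus j) = Vplus (j - i)"
| "source (Q i) (Vplus n) = Vminus (n - i - 1)"
| "source (Q i) (Vminus j) = Vplus (j - i)"
| "source _ k = k"

lemma idx_source: "idx (source g k) = idx k - hv_deg g"
  by (cases g; cases k) (simp_all add: hf_def)

text \<open>The comparison of the two actions.  Evaluating the coefficient \<open>L\<^sub>0 + m \<beta>\<close> of \<open>L\<^sub>m\<close> at the target index
  \<open>n + m\<close> gives \<open>-\<alpha>\<^sub>1 - n + m (\<beta>(-\<alpha>\<^sub>2) - 1)\<close>, whence the parameters \<open>c = -\<alpha>\<^sub>1\<close> and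
  \<open>a = \<beta>(-\<alpha>\<^sub>2) - 1\<close>; the coefficient \<open>H\<^sub>0\<close> gives \<open>b = -\<alpha>\<^sub>2\<close>.  The other coefficients follow the same pattern.\<close>

lemma Omega_gen_level:
  assumes l: "l \<noteq> 0"
    and u: "u \<in> level \<alpha> (idx (source g k))
      (place (series_parity (source g k)) (twist l (source g k) * Poly_Mapping.lookup v (source g k)))"
  shows "Omega_gen l \<beta> g u \<in> level \<alpha> (idx k) (place (series_parity k) (twist l k *
    Poly_Mapping.lookup (lin_ext (series_gen (poly \<beta> (- snd \<alpha>) - 1) (- snd \<alpha>) (- fst \<alpha>) g) v) k))"
proof -
  obtain f h where fh: "u = (f, h)" by (cases u)
  have pw: "l powi (n - m) = l powi n / l powi m" "l powi (m + 1) = l powi m * l" for m n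
    using l by (simp_all add: power_int_diff power_int_add)
  show ?thesis
    using u l unfolding idx_source fh
    by (cases g; cases k; simp add: level_def place_def zero_prod_def lookup_series_act
      lookup_series_act_zero pw hf_def; (simp add: field_simps)?)
qed

lemma coset_family_gen:
  assumes "l \<noteq> 0"
  shows "coset_family \<alpha> l (lin_ext (series_gen (poly \<beta> (- snd \<alpha>) - 1) (- snd \<alpha>) (- fst \<alpha>) g) v) =
    weighting_gen \<alpha> (Omega l \<beta>) g (coset_family \<alpha> l v)"
proof (rule half_ints_family_eqI)
  fix k
  let ?N = "lin_ext (series_gen (poly \<beta> (- snd \<alpha>) - 1) (- snd \<alpha>) (- fst \<alpha>) g) v"
  have "level \<alpha> (idx k) 0 <+>\<^bsub>Omega l \<beta>\<^esub>
      (act (Omega l \<beta>) (Poly_Mapping.single g 1) ` coset_family \<alpha> l v (idx (source g k))) =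
    level \<alpha> (idx k) (place (series_parity k) (twist l k * Poly_Mapping.lookup ?N k))"
    unfolding coset_family_idx
    by (rule level_image) (unfold act_Omega_single, rule Omega_gen_level[OF assms])
  then show "coset_family \<alpha> l ?N (idx k) = weighting_gen \<alpha> (Omega l \<beta>) g (coset_family \<alpha> l v) (idx k)"
    by (auto simp: weighting_gen_def wt_sub_Omega idx_source lookup_series_act_zero)
qed (simp_all add: weighting_gen_def)

theorem theorem6p4:
  fixes l :: complex and \<alpha> :: "complex \<times> complex" and \<beta> :: "complex poly"
  assumes "l \<noteq> 0"
  shows "weighting \<alpha> (Omega l \<beta>) \<cong>\<^sub>\<gg> series (poly \<beta> (- snd \<alpha>) - 1) (- snd \<alpha>) (- fst \<alpha>)"
proof (rule hv_iso_transport[of _ "coset_family \<alpha> l"])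
  show "coset_family \<alpha> l (act (series (poly \<beta> (- snd \<alpha>) - 1) (- snd \<alpha>) (- fst \<alpha>)) x v) =
      act (weighting \<alpha> (Omega l \<beta>)) x (coset_family \<alpha> l v)" for x v
    unfolding act_series lin_ext_def[of _ x] coset_family_sum[of _ _ _ _ \<beta>]
      coset_family_scale[of _ _ _ _ \<beta>] coset_family_gen[OF assms]
    by (simp only: weighting_simps full_weighting_simps)
qed (simp_all only: hv_module_series part_weighting_Omega[OF assms] weighting_simps(1-3)
    series_simps coset_family_zero coset_family_add coset_family_scale bij_betw_coset_family[OF assms])

end
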